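(* Let $(M,g,V)$ be a Riemannian $G$-manifold for which the intrinsic torsion takes values in a $G$-submodule $W\subset V\otimes\mathfrak g^{\perp}$. If $V$ and $W$ satisfy (a) $(V\otimes W\otimes S^2_0V)^G=\{0\}$ and (b) $(S^2W\otimes S^2_0V)^G=\{0\}$, then $(M,g,V)$ is $G$-irreducible (i.e. $V$ is an irreducible representation of $G$) and the intrinsic torsion is a three-form.
   Context: All representations are real; Lie groups are subgroups of orthogonal groups, and representations are identified with their duals; $\mathfrak{so}(V)\cong\Lambda^2V$. A $G$-manifold $(M,g,V)$ is a Riemannian manifold $(M^n,g)$ together with a reduction $P$ of the orthonormal frame bundle $O(M)$ to a Lie subgroup $G\subset O(n)$, where $V\cong\mathbb R^n$ is the induced representation of $G$ on tangent spaces. Tensor fields are identified with $G$-equivariant maps from $P$ to tensor powers of $V$; a tensor field "takes values in" a $G$-submodule $W$ if this map has image in $W$. Let $\mathfrak g\subset\mathfrak{so}(n)$ be the Lie algebra of $G$ and $\mathfrak g^{\perp}$ its orthogonal complement in $\mathfrak{so}(n)$. A $G$-connection is a connection whose holonomy group acts on tangent spaces as a subgroup of $G$. For a $G$-connection $\hat\nabla$ put $\eta=\nabla^g-\hat\nabla\in V\otimes\mathfrak{so}(n)$, with $\nabla^g$ the Levi-Civita connection; the component $\xi$ of $\eta$ in $V\otimes\mathfrak g^\perp$ is independent of $\hat\nabla$ and is called the intrinsic torsion. It is a three-form if it takes values in $\Lambda^3V\subset V\otimes\Lambda^2V\cong V\otimes\mathfrak{so}(n)$. $S^2_0V$ is the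 space of trace-free symmetric two-tensors on $V$, and $U^G$ denotes the $G$-invariants of a $G$-module $U$.
   Formalization: The G-irreducibility of V is claimed only for W ≠ {0}, since for W = {0} it fails (flat R^n, n ≥ 2, with G trivial satisfies (a) and (b) but V is reducible); the three-form claim is kept for all W. *)

theory Defs
  imports "HOL-Analysis.Analysis"
begin

section \<open>Smooth manifolds\<close>

text \<open>A manifold is a Hausdorff, second countable type \<open>'m\<close> (its points) with an atlas of charts
  into \<open>real^'n\<close>. The atlas need not be maximal.\<close>

text \<open>Meant for open \<open>S\<close> only.\<close>

fun Ck_on :: "nat \<Rightarrow> 'a::euclidean_space set \<Rightarrow> ('a \<Rightarrow> 'b::euclidean_space) \<Rightarrow> bool" where
  "Ck_on 0 S f \<longleftrightarrow> continuous_on S f"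
| "Ck_on (Suc k) S f \<longleftrightarrow>
     f differentiable_on S \<and> (\<forall>v. Ck_on k S (\<lambda>x. frechet_derivative f (at x) v))"

definition smooth_on :: "'a::euclidean_space set \<Rightarrow> ('a \<Rightarrow> 'b::euclidean_space) \<Rightarrow> bool" where
  "smooth_on S f \<longleftrightarrow> (\<forall>k. Ck_on k S f)"

type_synonym ('m, 'n) atlas = "('m set \<times> ('m \<Rightarrow> real^'n)) set"

definition smooth_atlas ::
    "('m::{t2_space,second_countable_topology}, 'n::finite) atlas \<Rightarrow> bool" where
  "smooth_atlas A \<longleftrightarrow>
     (\<Union>(U, \<phi>)\<in>A. U) = UNIV \<and>
     (\<forall>(U, \<phi>)\<in>A. open U \<and> open (\<phi> ` U) \<and> homeomorphism U (\<phi> ` U) \<phi> (inv_into U \<phi>)) \<and>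
     (\<forall>(U, \<phi>)\<in>A. \<forall>(U', \<phi>')\<in>A. smooth_on (\<phi> ` (U \<inter> U')) (\<phi>' \<circ> inv_into U \<phi>))"

definition smooth_fun ::
    "('m::{t2_space,second_countable_topology}, 'n::finite) atlas \<Rightarrow> ('m \<Rightarrow> real) \<Rightarrow> bool" where
  "smooth_fun A f \<longleftrightarrow> (\<forall>(U, \<phi>)\<in>A. smooth_on (\<phi> ` U) (f \<circ> inv_into U \<phi>))"

definition smooth_curve ::
    "('m::{t2_space,second_countable_topology}, 'n::finite) atlas \<Rightarrow> (real \<Rightarrow> 'm) \<Rightarrow> bool" where
  "smooth_curve A c \<longleftrightarrow>
     continuous_on UNIV c \<and> (\<forall>(U, \<phi>)\<in>A. smooth_on (c -` U) (\<phi> \<circ> c))"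

text \<open>Tangent vectors at \<open>x\<close> are the derivations at \<open>x\<close> of the algebra of smooth functions. They are
  normalised to vanish on non-smooth arguments, so that equality of derivations is equality in HOL;
  consequently the vector space operations are written pointwise.\<close>

type_synonym 'm tvec = "('m \<Rightarrow> real) \<Rightarrow> real"
type_synonym 'm vfield = "'m \<Rightarrow> 'm tvec"

definition tangent_space ::
    "('m::{t2_space,second_countable_topology}, 'n::finite) atlas \<Rightarrow> 'm \<Rightarrow> 'm tvec set" where
  "tangent_space A x =
     {v. (\<forall>f. \<not> smooth_fun A f \<longrightarrow> v f = 0) \<and>
         (\<forall>f h. smooth_fun A f \<longrightarrow> smooth_fun A h \<longrightarrow>
            v (\<lambda>y. f y + h y) = v f + v h \<and>
            v (\<lambda>y. f y * h y) = f x * v h + h x * v f) \<and>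
         (\<forall>f r. smooth_fun A f \<longrightarrow> v (\<lambda>y. r * f y) = r * v f)}"

definition velocity ::
    "('m::{t2_space,second_countable_topology}, 'n::finite) atlas \<Rightarrow> (real \<Rightarrow> 'm) \<Rightarrow> real \<Rightarrow> 'm tvec" where
  "velocity A c t = (\<lambda>f. if smooth_fun A f then deriv (f \<circ> c) t else 0)"

definition vector_field ::
    "('m::{t2_space,second_countable_topology}, 'n::finite) atlas \<Rightarrow> 'm vfield \<Rightarrow> bool" where
  "vector_field A X \<longleftrightarrow>
     (\<forall>x. X x \<in> tangent_space A x) \<and>
     (\<forall>f. smooth_fun A f \<longrightarrow> smooth_fun A (\<lambda>x. X x f))"

section \<open>Riemannian metrics and connections\<close>

type_synonym 'm metric = "'m \<Rightarrow> 'm tvec \<Rightarrow> 'm tvec \<Rightarrow> real"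

definition riemannian_metric ::
    "('m::{t2_space,second_countable_topology}, 'n::finite) atlas \<Rightarrow> 'm metric \<Rightarrow> bool" where
  "riemannian_metric A g \<longleftrightarrow>
     (\<forall>x. \<forall>u\<in>tangent_space A x. \<forall>v\<in>tangent_space A x.
        g x u v = g x v u \<and>
        (\<forall>w\<in>tangent_space A x. \<forall>r s.
           g x (\<lambda>f. r * u f + s * v f) w = r * g x u w + s * g x v w)) \<and>
     (\<forall>x. \<forall>u\<in>tangent_space A x. u \<noteq> (\<lambda>f. 0) \<longrightarrow> g x u u > 0) \<and>
     (\<forall>X Y. vector_field A X \<longrightarrow> vector_field A Y \<longrightarrow> smooth_fun A (\<lambda>x. g x (X x) (Y x)))"

text \<open>\<open>D X Y\<close> is the covariant derivative of \<open>Y\<close> in the direction \<open>X\<close>; only its values on smooth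
  vector fields are meaningful.\<close>

type_synonym 'm conn = "'m vfield \<Rightarrow> 'm vfield \<Rightarrow> 'm vfield"

definition connection ::
    "('m::{t2_space,second_countable_topology}, 'n::finite) atlas \<Rightarrow> 'm conn \<Rightarrow> bool" where
  "connection A D \<longleftrightarrow>
     (\<forall>X Y. vector_field A X \<longrightarrow> vector_field A Y \<longrightarrow>
        vector_field A (D X Y) \<and>
        (\<forall>Z. vector_field A Z \<longrightarrow>
           D (\<lambda>x f. X x f + Y x f) Z = (\<lambda>x f. D X Z x f + D Y Z x f) \<and>
           D Z (\<lambda>x f. X x f + Y x f) = (\<lambda>x f. D Z X x f + D Z Y x f)) \<and>
        (\<forall>h. smooth_fun A h \<longrightarrow>
           D (\<lambda>x f. h x * X x f) Y = (\<lambda>x f. h x * D X Y x f) \<and>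
           D X (\<lambda>x f. h x * Y x f) = (\<lambda>x f. h x * D X Y x f + X x h * Y x f)))"

definition levi_civita ::
    "('m::{t2_space,second_countable_topology}, 'n::finite) atlas \<Rightarrow> 'm metric \<Rightarrow> 'm conn \<Rightarrow> bool" where
  "levi_civita A g D \<longleftrightarrow>
     connection A D \<and>
     (\<forall>X Y Z x. vector_field A X \<longrightarrow> vector_field A Y \<longrightarrow> vector_field A Z \<longrightarrow>
        X x (\<lambda>y. g y (Y y) (Z y)) = g x (D X Y x) (Z x) + g x (Y x) (D X Z x)) \<and>
     (\<forall>X Y x f. vector_field A X \<longrightarrow> vector_field A Y \<longrightarrow> smooth_fun A f \<longrightarrow>
        D X Y x f - D Y X x f = X x (\<lambda>y. Y y f) - Y x (\<lambda>y. X y f))"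

text \<open>The field \<open>w\<close> along the curve \<open>c\<close> is parallel if at each time, for a local expression
  \<open>w t = (\<Sum>i. a\<^sub>i t E\<^sub>i (c t))\<close>, the covariant derivative
  \<open>\<Sum>i. a\<^sub>i' E\<^sub>i + a\<^sub>i D\<^bsub>c'\<^esub> E\<^sub>i\<close> vanishes.\<close>

definition parallel_along ::
    "('m::{t2_space,second_countable_topology}, 'n::finite) atlas \<Rightarrow> 'm conn \<Rightarrow> (real \<Rightarrow> 'm) \<Rightarrow>
     (real \<Rightarrow> 'm tvec) \<Rightarrow> bool" where
  "parallel_along A D c w \<longleftrightarrow>
     (\<forall>t. \<exists>(E :: 'n \<Rightarrow> 'm vfield) (a :: real \<Rightarrow> real^'n) (a' :: real^'n).
        (\<forall>i. vector_field A (E i)) \<and>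
        (\<forall>\<^sub>F s in nhds t. w s = (\<lambda>f. \<Sum>i\<in>UNIV. a s $ i * E i (c s) f)) \<and>
        (a has_vector_derivative a') (at t) \<and>
        (\<forall>X. vector_field A X \<longrightarrow> X (c t) = velocity A c t \<longrightarrow>
           (\<forall>f. (\<Sum>i\<in>UNIV. a' $ i * E i (c t) f + a t $ i * D X (E i) (c t) f) = 0)))"

section \<open>Lie subgroups of the orthogonal group\<close>

definition orthogonal_subgroup :: "(real^'n^'n) set \<Rightarrow> bool" where
  "orthogonal_subgroup G \<longleftrightarrow>
     (\<forall>h\<in>G. orthogonal_matrix h) \<and> mat 1 \<in> G \<and>
     (\<forall>h\<in>G. \<forall>k\<in>G. h ** k \<in> G) \<and> (\<forall>h\<in>G. matrix_inv h \<in> G)"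

definition one_parameter_subgroup :: "(real^'n^'n) set \<Rightarrow> (real \<Rightarrow> real^'n^'n) \<Rightarrow> bool" where
  "one_parameter_subgroup G \<gamma> \<longleftrightarrow>
     continuous_on UNIV \<gamma> \<and> (\<forall>t. \<gamma> t \<in> G) \<and> (\<forall>s t. \<gamma> (s + t) = \<gamma> s ** \<gamma> t)"

definition lie_algebra :: "(real^'n^'n) set \<Rightarrow> (real^'n^'n) set" where
  "lie_algebra G =
     {B. \<exists>\<gamma>. one_parameter_subgroup G \<gamma> \<and> (\<gamma> has_vector_derivative B) (at 0)}"

inductive_set identity_component :: "(real^'n^'n) set \<Rightarrow> (real^'n^'n) set"
  for G :: "(real^'n^'n) set" where
  one: "mat 1 \<in> identity_component G"
| step: "h \<in> identity_component G \<Longrightarrow> one_parameter_subgroup G \<gamma> \<Longrightarrow>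
           h ** \<gamma> t \<in> identity_component G"

text \<open>Lie subgroups are not required to be closed. The one-parameter subgroups of an arbitrary
  subgroup \<open>G\<close> generate a connected immersed Lie subgroup (by Yamabe's theorem); hence \<open>G\<close> is an
  immersed Lie subgroup, with the usual second countable topology, precisely when the latter has
  countably many cosets in \<open>G\<close>. In particular all closed subgroups qualify.\<close>

definition lie_subgroup :: "(real^'n^'n) set \<Rightarrow> bool" where
  "lie_subgroup G \<longleftrightarrow>
     orthogonal_subgroup G \<and>
     (\<exists>C. countable C \<and> G = {h ** k | h k. h \<in> C \<and> k \<in> identity_component G})"

section \<open>\<open>G\<close>-structures and \<open>G\<close>-connections\<close>

text \<open>A frame at \<open>x\<close> is a linear isomorphism from \<open>V = real^'n\<close> onto the tangent space; the
  orthogonal group acts on frames from the right by precomposition. A set of frames is given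
  by its fibres.\<close>

type_synonym ('m, 'n) frame = "real^'n \<Rightarrow> 'm tvec"

definition orthonormal_frames ::
    "('m::{t2_space,second_countable_topology}, 'n::finite) atlas \<Rightarrow> 'm metric \<Rightarrow> 'm \<Rightarrow>
     ('m, 'n) frame set" where
  "orthonormal_frames A g x =
     {p. (\<forall>f. linear (\<lambda>a. p a f)) \<and> bij_betw p UNIV (tangent_space A x) \<and>
         (\<forall>a b. g x (p a) (p b) = a \<bullet> b)}"

text \<open>The last clause says that there are smooth local sections: local frame fields extend to global
  vector fields after shrinking their domain. As Lie subgroups are initial submanifolds, the
  transition functions between such sections are automatically smooth as maps into \<open>G\<close>.\<close>

definition reduction ::
    "('m::{t2_space,second_countable_topology}, 'n::finite) atlas \<Rightarrow> 'm metric \<Rightarrow>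
     (real^'n^'n) set \<Rightarrow> ('m \<Rightarrow> ('m, 'n) frame set) \<Rightarrow> bool" where
  "reduction A g G P \<longleftrightarrow>
     (\<forall>x. P x \<noteq> {} \<and> P x \<subseteq> orthonormal_frames A g x) \<and>
     (\<forall>x. \<forall>p\<in>P x. P x = {\<lambda>a. p (h *v a) | h. h \<in> G}) \<and>
     (\<forall>x. \<exists>U (E :: 'n \<Rightarrow> 'm vfield). open U \<and> x \<in> U \<and> (\<forall>i. vector_field A (E i)) \<and>
        (\<forall>y\<in>U. (\<lambda>a f. \<Sum>i\<in>UNIV. a $ i * E i y f) \<in> P y))"

definition riemannian_G_manifold ::
    "('m::{t2_space,second_countable_topology}, 'n::finite) atlas \<Rightarrow> 'm metric \<Rightarrow>
     (real^'n^'n) set \<Rightarrow> ('m \<Rightarrow> ('m, 'n) frame set) \<Rightarrow> bool" where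
  "riemannian_G_manifold A g G P \<longleftrightarrow>
     smooth_atlas A \<and> riemannian_metric A g \<and> lie_subgroup G \<and> reduction A g G P"

text \<open>Parallel transport maps adapted frames to adapted frames. (The weaker condition on loops
  only would not tie the connection to \<open>P\<close>.)\<close>

definition G_connection ::
    "('m::{t2_space,second_countable_topology}, 'n::finite) atlas \<Rightarrow>
     ('m \<Rightarrow> ('m, 'n) frame set) \<Rightarrow> 'm conn \<Rightarrow> bool" where
  "G_connection A P D \<longleftrightarrow>
     connection A D \<and>
     (\<forall>c (u :: real \<Rightarrow> ('m, 'n) frame).
        smooth_curve A c \<longrightarrow> (\<forall>a. parallel_along A D c (\<lambda>t. u t a)) \<longrightarrow>
        u 0 \<in> P (c 0) \<longrightarrow> (\<forall>t. u t \<in> P (c t)))"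

section \<open>Tensor representations\<close>

text \<open>A tensor product of subspaces of \<open>real^'a\<close> and \<open>real^'b\<close> is realised inside \<open>real^('a \<times> 'b)\<close>.
  If \<open>h\<close> and \<open>k\<close> are the matrices by which a group element acts on the factors, then
  \<open>kron h k\<close> is the matrix of its action on the tensor product.\<close>

definition tensor :: "real^'a \<Rightarrow> real^'b \<Rightarrow> real^('a::finite \<times> 'b::finite)" where
  "tensor u v = (\<chi> i. u $ fst i * v $ snd i)"

definition tensor_product ::
    "(real^'a) set \<Rightarrow> (real^'b) set \<Rightarrow> (real^('a::finite \<times> 'b::finite)) set" (infixr "\<otimes>" 70) where
  "U \<otimes> W = span {tensor u w | u w. u \<in> U \<and> w \<in> W}"

definition kron ::
    "real^'a^'a \<Rightarrow> real^'b^'b \<Rightarrow> real^('a::finite \<times> 'b::finite)^('a \<times> 'b)" where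
  "kron h k = (\<chi> i j. h $ fst i $ fst j * k $ snd i $ snd j)"

definition tensor2_rep :: "real^'n^'n \<Rightarrow> real^('n::finite \<times> 'n)^('n \<times> 'n)" where
  "tensor2_rep h = kron h h"

definition tensor3_rep ::
    "real^'n^'n \<Rightarrow> real^('n::finite \<times> 'n \<times> 'n)^('n \<times> 'n \<times> 'n)" where
  "tensor3_rep h = kron h (tensor2_rep h)"

definition submodule :: "'g set \<Rightarrow> ('g \<Rightarrow> real^'a^'a) \<Rightarrow> (real^'a::finite) set \<Rightarrow> bool" where
  "submodule G \<rho> U \<longleftrightarrow> subspace U \<and> (\<forall>h\<in>G. \<forall>u\<in>U. \<rho> h *v u \<in> U)"

definition invariants :: "'g set \<Rightarrow> ('g \<Rightarrow> real^'a^'a) \<Rightarrow> (real^'a::finite) set \<Rightarrow> (real^'a) set" where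
  "invariants G \<rho> U = {u \<in> U. \<forall>h\<in>G. \<rho> h *v u = u}"

definition irreducible_rep :: "'g set \<Rightarrow> ('g \<Rightarrow> real^'a::finite^'a) \<Rightarrow> bool" where
  "irreducible_rep G \<rho> \<longleftrightarrow> (\<forall>U. submodule G \<rho> U \<longrightarrow> U = {0} \<or> U = UNIV)"

definition Sym2 :: "(real^'a::finite) set \<Rightarrow> (real^('a \<times> 'a)) set" where
  "Sym2 U = {t \<in> U \<otimes> U. \<forall>i j. t $ (i, j) = t $ (j, i)}"

definition Sym2_0 :: "(real^('n::finite \<times> 'n)) set" where
  "Sym2_0 = {t \<in> Sym2 UNIV. (\<Sum>i\<in>UNIV. t $ (i, i)) = 0}"

definition mat_tensor :: "real^'n^'n \<Rightarrow> real^('n::finite \<times> 'n)" where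
  "mat_tensor B = (\<chi> i. B $ fst i $ snd i)"

text \<open>Under \<open>mat_tensor\<close> the Lie algebra of skew matrices becomes \<open>\<Lambda>\<^sup>2V = Alt2\<close>.\<close>

definition Alt2 :: "(real^('n::finite \<times> 'n)) set" where
  "Alt2 = {t. \<forall>i j. t $ (i, j) = - t $ (j, i)}"

definition Alt3 :: "(real^('n::finite \<times> 'n \<times> 'n)) set" where
  "Alt3 = {t. \<forall>i j k. t $ (i, j, k) = - t $ (j, i, k) \<and> t $ (i, j, k) = - t $ (i, k, j)}"

definition lie_algebra_perp :: "(real^'n^'n) set \<Rightarrow> (real^('n::finite \<times> 'n)) set" where
  "lie_algebra_perp G = {t \<in> Alt2. \<forall>B\<in>lie_algebra G. t \<bullet> mat_tensor B = 0}"

section \<open>Intrinsic torsion\<close>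

text \<open>Tensor fields are evaluated on an adapted frame \<open>p\<close> at \<open>x\<close>. For \<open>\<eta> = D - D'\<close>, the entry
  \<open>(i, j, k)\<close> is the matrix entry \<open>(j, k)\<close> of the endomorphism \<open>\<eta>\<close> in direction \<open>e\<^sub>i\<close>; it does not depend
  on the vector fields \<open>X\<close> and \<open>Y\<close> that extend the frame vectors.\<close>

definition difference_tensor ::
    "('m::{t2_space,second_countable_topology}, 'n::finite) atlas \<Rightarrow> 'm metric \<Rightarrow>
     'm conn \<Rightarrow> 'm conn \<Rightarrow> 'm \<Rightarrow> ('m, 'n) frame \<Rightarrow> real^('n \<times> 'n \<times> 'n)" where
  "difference_tensor A g D D' x p =
     (\<chi> m. case m of (i, j, k) \<Rightarrow>
        (THE r. \<forall>X Y. vector_field A X \<longrightarrow> vector_field A Y \<longrightarrow>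
           X x = p (axis i 1) \<longrightarrow> Y x = p (axis k 1) \<longrightarrow>
           r = g x (\<lambda>f. D X Y x f - D' X Y x f) (p (axis j 1))))"

definition intrinsic_torsion ::
    "('m::{t2_space,second_countable_topology}, 'n::finite) atlas \<Rightarrow> 'm metric \<Rightarrow>
     (real^'n^'n) set \<Rightarrow> ('m \<Rightarrow> ('m, 'n) frame set) \<Rightarrow> 'm \<Rightarrow> ('m, 'n) frame \<Rightarrow>
     real^('n \<times> 'n \<times> 'n)" where
  "intrinsic_torsion A g G P x p =
     (THE \<xi>. \<xi> \<in> UNIV \<otimes> lie_algebra_perp G \<and>
        (\<forall>D D'. levi_civita A g D \<longrightarrow> G_connection A P D' \<longrightarrow>
           difference_tensor A g D D' x p - \<xi> \<in> UNIV \<otimes> mat_tensor ` lie_algebra G))"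

definition takes_values_in ::
    "('m \<Rightarrow> ('m, 'n) frame set) \<Rightarrow> ('m \<Rightarrow> ('m, 'n) frame \<Rightarrow> real^'k) \<Rightarrow> (real^'k) set \<Rightarrow> bool" where
  "takes_values_in P \<tau> W \<longleftrightarrow> (\<forall>x. \<forall>p\<in>P x. \<tau> x p \<in> W)"

end

theory Submission
  imports Defs
begin

text \<open>Only the algebra of \<open>W\<close> matters. An orthonormal basis of the submodule \<open>W\<close> gives the Casimir
  element \<open>\<Sum>w \<otimes> w\<close>, which is invariant because \<open>G\<close> acts orthogonally. If \<open>V\<close> has a proper
  submodule \<open>U\<close>, the trace-free part of the Casimir element of \<open>U\<close> is a nonzero invariant in
  \<open>S\<^sup>2\<^sub>0V\<close>, and its product with the Casimir element of \<open>W\<close> contradicts (b). Symmetrising the first two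
  indices and removing the trace is an equivariant map \<open>W \<rightarrow> V \<otimes> S\<^sup>2\<^sub>0V\<close>, which vanishes by (a). Hence
  \<open>\<xi>\<^sub>i\<^sub>j\<^sub>k + \<xi>\<^sub>j\<^sub>i\<^sub>k = (2/n) \<delta>\<^sub>i\<^sub>j \<tau>\<^sub>k\<close> with \<open>\<tau>\<^sub>k = \<Sum>\<^sub>i \<xi>\<^sub>i\<^sub>i\<^sub>k\<close>; contracting \<open>i\<close> with \<open>k\<close> and using skewness in the
  last two indices gives \<open>-\<tau>\<^sub>j = (2/n) \<tau>\<^sub>j\<close>, so \<open>\<tau> = 0\<close> and \<open>\<xi>\<close> is totally skew.\<close>

section \<open>Tensor products of vectors and Kronecker products of matrices\<close>

lemma bilinear_tensor: "bilinear tensor"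
  unfolding bilinear_def
  by (auto intro!: linearI simp: tensor_def vec_eq_iff algebra_simps)

lemma tensor_nth [simp]: "tensor u v $ (i, j) = u $ i * v $ j"
  by (simp add: tensor_def)

lemma tensor_eq_0_iff: "tensor u v = 0 \<longleftrightarrow> u = 0 \<or> v = 0"
  by (auto simp: vec_eq_iff tensor_def)

lemma tensor_in_tensor_product: "u \<in> U \<Longrightarrow> w \<in> W \<Longrightarrow> tensor u w \<in> U \<otimes> W"
  unfolding tensor_product_def by (auto intro: span_base)

lemma subspace_tensor_product: "subspace (U \<otimes> W)"
  unfolding tensor_product_def by (rule subspace_span)

lemma sum_UNIV_prod:
  fixes f :: "'a::finite \<times> 'b::finite \<Rightarrow> 'c::comm_monoid_add"
  shows "sum f UNIV = (\<Sum>i\<in>UNIV. \<Sum>j\<in>UNIV. f (i, j))"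
  unfolding UNIV_Times_UNIV[symmetric] sum.cartesian_product by simp

lemma tensor_product_UNIV:
  "(UNIV :: (real^'a::finite) set) \<otimes> (UNIV :: (real^'b::finite) set) = UNIV"
proof -
  have "t \<in> UNIV \<otimes> UNIV" for t :: "real^('a \<times> 'b)"
  proof -
    have "tensor (axis (fst p) 1) (axis (snd p) 1) = (axis p 1 :: real^('a \<times> 'b))" for p
      by (cases p) (auto simp: vec_eq_iff axis_def)
    then have "t = (\<Sum>p\<in>UNIV. t $ p *\<^sub>R tensor (axis (fst p) 1) (axis (snd p) 1))"
      using basis_expansion[of t] by (simp add: scalar_mult_eq_scaleR)
    also have "\<dots> \<in> UNIV \<otimes> UNIV"
      by (intro subspace_sum subspace_scale subspace_tensor_product tensor_in_tensor_product UNIV_I)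
    finally show ?thesis .
  qed
  then show ?thesis by blast
qed

lemma kron_nth [simp]: "kron h k $ (i, i') $ (j, j') = h $ i $ j * k $ i' $ j'"
  by (simp add: kron_def)

lemma kron_tensor: "kron h k *v tensor u v = tensor (h *v u) (k *v v)"
  by (auto simp: vec_eq_iff matrix_vector_mult_def sum_UNIV_prod sum_product algebra_simps)

lemma transpose_kron: "transpose (kron h k) = kron (transpose h) (transpose k)"
  by (simp add: vec_eq_iff transpose_def)

lemma kron_mult: "kron h k ** kron h' k' = kron (h ** h') (k ** k')"
  by (auto simp: vec_eq_iff matrix_matrix_mult_def sum_UNIV_prod sum_product algebra_simps)

lemma kron_mat_1: "kron (mat 1) (mat 1) = mat 1"
  by (auto simp: vec_eq_iff mat_def)

lemma orthogonal_matrix_kron: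
  "orthogonal_matrix h \<Longrightarrow> orthogonal_matrix k \<Longrightarrow> orthogonal_matrix (kron h k)"
  by (simp add: orthogonal_matrix_def transpose_kron kron_mult kron_mat_1)

lemma orthogonal_matrix_tensor2_rep: "orthogonal_matrix h \<Longrightarrow> orthogonal_matrix (tensor2_rep h)"
  by (simp add: tensor2_rep_def orthogonal_matrix_kron)

lemma orthogonal_matrix_tensor3_rep: "orthogonal_matrix h \<Longrightarrow> orthogonal_matrix (tensor3_rep h)"
  by (simp add: tensor3_rep_def orthogonal_matrix_kron orthogonal_matrix_tensor2_rep)

lemma transpose_tensor3_rep: "transpose (tensor3_rep h) = tensor3_rep (transpose h)"
  by (simp add: tensor3_rep_def tensor2_rep_def transpose_kron)

section \<open>Orthogonal groups and orthonormal bases\<close>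

lemma orthogonal_matrix_inner:
  fixes R :: "real^'a^'a"
  assumes "orthogonal_matrix R"
  shows "(R *v x) \<bullet> (R *v y) = x \<bullet> y"
  using assms orthogonal_transformation_matrix[of "(*v) R"]
  by (simp add: orthogonal_transformation_def)

text \<open>The inverse of an orthogonal matrix is its transpose. This makes submodules stable under
  the adjoint of each group element as well.\<close>

lemma orthogonal_subgroup_transpose:
  assumes "orthogonal_subgroup G" "h \<in> G"
  shows "transpose h \<in> G"
proof -
  have "orthogonal_matrix h"
    using assms by (auto simp: orthogonal_subgroup_def)
  then have h: "h ** transpose h = mat 1" "transpose h ** h = mat 1"
    by (simp_all add: orthogonal_matrix_def)
  \<comment> \<open>\<open>matrix_inv\<close> is a choice, so its defining property becomes
    available only once some two-sided inverse is exhibited.\<close>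
  then have "\<exists>k. h ** k = mat 1 \<and> k ** h = mat 1"
    by blast
  from someI_ex[OF this] have "h ** matrix_inv h = mat 1"
    by (simp add: matrix_inv_def)
  then have "matrix_inv h = transpose h"
    using h(2) matrix_mul_assoc[of "transpose h" h "matrix_inv h"] by simp
  then show ?thesis
    using assms by (metis orthogonal_subgroup_def)
qed

definition orthonormal_basis :: "(real^'a::finite) set \<Rightarrow> (real^'a) set \<Rightarrow> bool" where
  "orthonormal_basis W B \<longleftrightarrow>
     finite B \<and> pairwise orthogonal B \<and> (\<forall>w\<in>B. norm w = 1) \<and> span B = W"

lemma orthonormal_basis_exists:
  assumes "subspace W"
  obtains B where "orthonormal_basis W B" "card B = dim W"
proof -
  obtain B where "pairwise orthogonal B" "\<And>w. w \<in> B \<Longrightarrow> norm w = 1" "independent B"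
      "card B = dim W" "span B = W"
    using orthonormal_basis_subspace[OF assms] by metis
  then show ?thesis
    using that independent_imp_finite by (auto simp: orthonormal_basis_def)
qed

lemma orthonormal_basis_expand_sum:
  assumes "orthonormal_basis W B" "x \<in> W"
  shows "(\<Sum>w\<in>B. (w \<bullet> x) *\<^sub>R w) = x"
  using assms orthonormal_basis_expand[of B x]
  by (simp add: orthonormal_basis_def inner_commute)

lemma orthonormal_basis_inner:
  assumes "orthonormal_basis W B" "v \<in> B" "w \<in> B"
  shows "v \<bullet> w = (if v = w then 1 else 0)"
proof (cases "v = w")
  case True
  then show ?thesis
    using assms by (simp add: orthonormal_basis_def dot_square_norm)
next
  case False
  then show ?thesis
    using assms by (simp add: orthonormal_basis_def pairwise_def orthogonal_def)
qed

lemma orthonormal_basis_parseval: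
  assumes "orthonormal_basis W B" "x \<in> W"
  shows "(\<Sum>w\<in>B. (w \<bullet> x) * (w \<bullet> y)) = x \<bullet> y"
proof -
  have "x \<bullet> y = (\<Sum>w\<in>B. (w \<bullet> x) *\<^sub>R w) \<bullet> y"
    by (simp add: orthonormal_basis_expand_sum[OF assms])
  then show ?thesis by (simp add: inner_sum_left)
qed

text \<open>\<open>R\<close> carries \<open>B\<close> to another orthonormal basis of
  \<open>W\<close>, and the sum does not depend on the basis. It is stated for any bilinear
  \<open>b\<close> because it serves both the Casimir element and the invariant built from the
  symmetrisation map.\<close>

lemma sum_orthonormal_basis_orthogonal_matrix:
  fixes R :: "real^'a^'a" and b :: "real^'a \<Rightarrow> real^'a \<Rightarrow> 'b::real_vector"
  assumes B: "orthonormal_basis W B" and b: "bilinear b"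
    and RW: "\<And>w. w \<in> W \<Longrightarrow> R *v w \<in> W"
    and RtW: "\<And>w. w \<in> W \<Longrightarrow> transpose R *v w \<in> W"
    and R: "orthogonal_matrix R"
  shows "(\<Sum>w\<in>B. b (R *v w) (R *v w)) = (\<Sum>w\<in>B. b w w)"
proof -
  have fin: "finite B" and BW: "\<And>w. w \<in> B \<Longrightarrow> w \<in> W"
    using B by (auto simp: orthonormal_basis_def intro: span_base)
  have "b (R *v w) (R *v w) = (\<Sum>u\<in>B. \<Sum>v\<in>B. ((u \<bullet> (R *v w)) * (v \<bullet> (R *v w))) *\<^sub>R b u v)"
    if "w \<in> B" for w
  proof -
    have "b (R *v w) (R *v w) =
        b (\<Sum>u\<in>B. (u \<bullet> (R *v w)) *\<^sub>R u) (\<Sum>v\<in>B. (v \<bullet> (R *v w)) *\<^sub>R v)"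
      by (simp add: orthonormal_basis_expand_sum[OF B] RW BW that)
    also have "\<dots> = (\<Sum>u\<in>B. \<Sum>v\<in>B. ((u \<bullet> (R *v w)) * (v \<bullet> (R *v w))) *\<^sub>R b u v)"
      by (simp add: bilinear_sum[OF b] sum.cartesian_product bilinear_lmul[OF b]
          bilinear_rmul[OF b] mult.commute)
    finally show ?thesis .
  qed
  then have "(\<Sum>w\<in>B. b (R *v w) (R *v w)) =
      (\<Sum>w\<in>B. \<Sum>u\<in>B. \<Sum>v\<in>B. ((u \<bullet> (R *v w)) * (v \<bullet> (R *v w))) *\<^sub>R b u v)"
    by simp
  also have "\<dots> = (\<Sum>u\<in>B. \<Sum>v\<in>B. (\<Sum>w\<in>B. (u \<bullet> (R *v w)) * (v \<bullet> (R *v w))) *\<^sub>R b u v)"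
    unfolding scaleR_sum_left by (subst sum.swap) (intro sum.cong refl sum.swap)
  also have "\<dots> = (\<Sum>u\<in>B. \<Sum>v\<in>B. (u \<bullet> v) *\<^sub>R b u v)"
  proof (intro sum.cong refl)
    fix u v assume uv: "u \<in> B" "v \<in> B"
    \<comment> \<open>After moving \<open>R\<close> across the inner product, Parseval applies
      because \<open>RtW\<close> keeps \<open>transpose R *v u\<close> in \<open>W\<close>.\<close>
    have "(\<Sum>w\<in>B. (u \<bullet> (R *v w)) * (v \<bullet> (R *v w))) =
        (\<Sum>w\<in>B. (w \<bullet> (transpose R *v u)) * (w \<bullet> (transpose R *v v)))"
      by (simp add: dot_lmul_matrix[symmetric] inner_commute)
    also have "\<dots> = (transpose R *v u) \<bullet> (transpose R *v v)"
      by (intro orthonormal_basis_parseval[OF B] RtW BW uv)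
    also have "\<dots> = u \<bullet> v"
      using R by (intro orthogonal_matrix_inner) (simp add: orthogonal_matrix_transpose)
    finally show "(\<Sum>w\<in>B. (u \<bullet> (R *v w)) * (v \<bullet> (R *v w))) *\<^sub>R b u v = (u \<bullet> v) *\<^sub>R b u v"
      by simp
  qed
  also have "\<dots> = (\<Sum>u\<in>B. \<Sum>v\<in>B. if u = v then b u v else 0)"
    by (intro sum.cong refl) (simp add: orthonormal_basis_inner[OF B])
  also have "\<dots> = (\<Sum>w\<in>B. b w w)"
    using fin by simp
  finally show ?thesis .
qed

section \<open>Casimir elements of submodules\<close>

definition casimir :: "(real^'a::finite) set \<Rightarrow> real^('a \<times> 'a)" where
  "casimir B = (\<Sum>w\<in>B. tensor w w)"

lemma casimir_invariant:
  assumes "orthonormal_basis W B" "orthogonal_matrix R"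
    and "\<And>w. w \<in> W \<Longrightarrow> R *v w \<in> W" "\<And>w. w \<in> W \<Longrightarrow> transpose R *v w \<in> W"
  shows "kron R R *v casimir B = casimir B"
  using sum_orthonormal_basis_orthogonal_matrix[OF assms(1) bilinear_tensor assms(3,4,2)]
  by (simp add: casimir_def linear_sum[OF matrix_vector_mul_linear] kron_tensor)

lemma casimir_symmetric: "casimir B $ (i, j) = casimir B $ (j, i)"
  by (simp add: casimir_def mult.commute)

lemma casimir_in_Sym2:
  assumes "orthonormal_basis W B"
  shows "casimir B \<in> Sym2 W"
proof -
  have "B \<subseteq> W"
    using assms span_superset by (auto simp: orthonormal_basis_def)
  then have "casimir B \<in> W \<otimes> W"
    unfolding casimir_def
    by (intro subspace_sum subspace_tensor_product tensor_in_tensor_product) auto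
  then show ?thesis
    using casimir_symmetric[of B] by (auto simp: Sym2_def)
qed

text \<open>Each unit vector contributes 1. The value serves twice: to make an element trace-free
  and to see that a Casimir element is nonzero.\<close>

lemma trace_casimir:
  assumes "orthonormal_basis W B"
  shows "(\<Sum>i\<in>UNIV. casimir B $ (i, i)) = real (card B)"
proof -
  have "(\<Sum>i\<in>UNIV. casimir B $ (i, i)) = (\<Sum>w\<in>B. w \<bullet> w)"
    by (simp add: casimir_def inner_vec_def sum.swap[of _ B])
  also have "\<dots> = real (card B)"
    by (simp add: orthonormal_basis_inner[OF assms])
  finally show ?thesis .
qed

text \<open>Read as a matrix, the Casimir element is the orthogonal projection onto
  \<open>W\<close>, which fixes \<open>W\<close> pointwise.\<close>

lemma casimir_contract:
  assumes "orthonormal_basis W B" "x \<in> W"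
  shows "(\<Sum>j\<in>UNIV. casimir B $ (i, j) * x $ j) = x $ i"
proof -
  have "(\<Sum>j\<in>UNIV. casimir B $ (i, j) * x $ j) = (\<Sum>w\<in>B. \<Sum>j\<in>UNIV. w $ i * w $ j * x $ j)"
    by (simp add: casimir_def sum_distrib_right sum.swap[of _ B])
  also have "\<dots> = (\<Sum>w\<in>B. (w \<bullet> x) *\<^sub>R w) $ i"
    by (simp add: inner_vec_def sum_distrib_left sum_distrib_right algebra_simps)
  finally show ?thesis
    by (simp add: orthonormal_basis_expand_sum[OF assms])
qed

section \<open>The equivariant projection onto trace-free symmetric two-tensors\<close>

definition metric_tensor :: "real^('n::finite \<times> 'n)" where
  "metric_tensor = mat_tensor (mat 1)"

lemma metric_tensor_nth [simp]: "metric_tensor $ (i, j) = (if i = j then 1 else 0)"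
  by (simp add: metric_tensor_def mat_tensor_def mat_def)

lemma inner_metric_tensor: "t \<bullet> metric_tensor = (\<Sum>i\<in>UNIV. t $ (i, i))"
  by (simp add: inner_vec_def sum_UNIV_prod if_distrib cong: if_cong)

lemma tensor2_rep_metric_tensor:
  assumes "orthogonal_matrix h"
  shows "tensor2_rep h *v metric_tensor = metric_tensor"
proof -
  have "h ** transpose h = mat 1"
    using assms by (simp add: orthogonal_matrix_def)
  then have "(\<Sum>k\<in>UNIV. h $ i $ k * h $ j $ k) = (if i = j then 1 else 0)" for i j
    by (simp add: vec_eq_iff matrix_matrix_mult_def transpose_def mat_def)
  then show ?thesis
    by (simp add: vec_eq_iff matrix_vector_mult_def tensor2_rep_def sum_UNIV_prod if_distrib
        cong: if_cong)
qed

definition swap_tensor :: "real^('n::finite \<times> 'n) \<Rightarrow> real^('n \<times> 'n)" where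
  "swap_tensor t = (\<chi> p. t $ (snd p, fst p))"

lemma swap_tensor_tensor2_rep: "swap_tensor (tensor2_rep h *v t) = tensor2_rep h *v swap_tensor t"
proof -
  have "(\<Sum>k\<in>UNIV. \<Sum>l\<in>UNIV. h $ j $ k * h $ i $ l * t $ (k, l)) =
      (\<Sum>l\<in>UNIV. \<Sum>k\<in>UNIV. h $ i $ l * h $ j $ k * t $ (k, l))" for i j
    by (subst sum.swap) (simp add: mult.commute)
  then show ?thesis
    by (simp add: vec_eq_iff swap_tensor_def matrix_vector_mult_def tensor2_rep_def sum_UNIV_prod)
qed

text \<open>Twice the orthogonal projection onto \<open>Sym2_0\<close>: the metric has trace n, so
  the factor 2/n cancels the doubled trace of \<open>t\<close>.\<close>

definition sym_tracefree :: "real^('n::finite \<times> 'n) \<Rightarrow> real^('n \<times> 'n)" where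
  "sym_tracefree t =
     t + swap_tensor t - (2 / real CARD('n) * (t \<bullet> metric_tensor)) *\<^sub>R metric_tensor"

lemma linear_sym_tracefree: "linear sym_tracefree"
  by (rule linearI)
     (auto simp: sym_tracefree_def swap_tensor_def vec_eq_iff inner_add_left algebra_simps
       add_divide_distrib)

lemma sym_tracefree_in_Sym2_0: "sym_tracefree t \<in> Sym2_0"
proof -
  have "sym_tracefree t $ (i, j) = sym_tracefree t $ (j, i)" for i j
    by (simp add: sym_tracefree_def swap_tensor_def)
  moreover have "(\<Sum>i\<in>UNIV. sym_tracefree t $ (i, i)) = 0"
    by (simp add: sym_tracefree_def swap_tensor_def sum.distrib sum_subtractf
        inner_metric_tensor sum_distrib_left[symmetric])
  ultimately show ?thesis
    by (simp add: Sym2_0_def Sym2_def tensor_product_UNIV)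
qed

text \<open>The action commutes with the swap, fixes the metric and is isometric, so it also
  preserves the trace \<open>t \<bullet> metric_tensor\<close>.\<close>

lemma sym_tracefree_tensor2_rep:
  assumes "orthogonal_matrix h"
  shows "sym_tracefree (tensor2_rep h *v t) = tensor2_rep h *v sym_tracefree t"
proof -
  have "(tensor2_rep h *v t) \<bullet> metric_tensor = t \<bullet> metric_tensor"
    using orthogonal_matrix_inner[OF orthogonal_matrix_tensor2_rep[OF assms], of t metric_tensor]
    by (simp add: tensor2_rep_metric_tensor[OF assms])
  then show ?thesis
    by (simp add: sym_tracefree_def swap_tensor_tensor2_rep matrix_vector_right_distrib
        matrix_vector_mult_diff_distrib matrix_vector_mult_scaleR tensor2_rep_metric_tensor[OF assms])
qed

section \<open>The symmetrisation map and its vanishing under condition (a)\<close>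

definition slice :: "'n \<Rightarrow> real^('n::finite \<times> 'n \<times> 'n) \<Rightarrow> real^('n \<times> 'n)" where
  "slice k x = (\<chi> p. x $ (fst p, snd p, k))"

lemma linear_slice: "linear (slice k)"
  by (rule linearI) (simp_all add: slice_def vec_eq_iff)

lemma slice_tensor3_rep:
  "slice k (tensor3_rep h *v x) = (\<Sum>l\<in>UNIV. h $ k $ l *\<^sub>R (tensor2_rep h *v slice l x))"
proof -
  have "(\<Sum>a\<in>UNIV. \<Sum>b\<in>UNIV. \<Sum>l\<in>UNIV. h $ i $ a * (h $ j $ b * h $ k $ l) * x $ (a, b, l)) =
      (\<Sum>l\<in>UNIV. h $ k $ l * (\<Sum>a\<in>UNIV. \<Sum>b\<in>UNIV. h $ i $ a * h $ j $ b * x $ (a, b, l)))"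
      (is "?L = ?R") for i j
  proof -
    have "?L = (\<Sum>a\<in>UNIV. \<Sum>l\<in>UNIV. \<Sum>b\<in>UNIV.
        h $ i $ a * (h $ j $ b * h $ k $ l) * x $ (a, b, l))"
      by (intro sum.cong refl sum.swap)
    also have "\<dots> = (\<Sum>l\<in>UNIV. \<Sum>a\<in>UNIV. \<Sum>b\<in>UNIV.
        h $ i $ a * (h $ j $ b * h $ k $ l) * x $ (a, b, l))"
      by (rule sum.swap)
    also have "\<dots> = ?R"
      by (simp add: sum_distrib_left algebra_simps)
    finally show ?thesis .
  qed
  then show ?thesis
    by (simp add: vec_eq_iff slice_def matrix_vector_mult_def tensor3_rep_def tensor2_rep_def
        sum_UNIV_prod)
qed

text \<open>The component, at index \<open>k\<close> of the factor \<open>V\<close>, of an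
  equivariant map phi into \<open>V \<otimes> S\<^sup>2\<^sub>0V\<close>.\<close>

definition sym_map :: "'n \<Rightarrow> real^('n::finite \<times> 'n \<times> 'n) \<Rightarrow> real^('n \<times> 'n)" where
  "sym_map k x = sym_tracefree (slice k x)"

lemma linear_sym_map: "linear (sym_map k)"
  using linear_compose[OF linear_slice linear_sym_tracefree]
  by (simp add: sym_map_def[abs_def] o_def)

lemma sym_map_tensor3_rep:
  assumes "orthogonal_matrix h"
  shows "sym_map k (tensor3_rep h *v x) = (\<Sum>l\<in>UNIV. h $ k $ l *\<^sub>R (tensor2_rep h *v sym_map l x))"
  by (simp add: sym_map_def slice_tensor3_rep linear_sum[OF linear_sym_tracefree]
      linear_cmul[OF linear_sym_tracefree] sym_tracefree_tensor2_rep[OF assms])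

text \<open>The tensor product of \<open>v\<close> with phi(\<open>w\<close>), its factors permuted
  to the order used in condition (a).\<close>

definition torsion_tensor ::
    "real^('n::finite \<times> 'n \<times> 'n) \<Rightarrow> real^('n \<times> 'n \<times> 'n) \<Rightarrow>
     real^('n \<times> ('n \<times> 'n \<times> 'n) \<times> ('n \<times> 'n))" where
  "torsion_tensor v w = (\<Sum>k\<in>UNIV. tensor (axis k 1) (tensor v (sym_map k w)))"

lemma torsion_tensor_nth:
  "torsion_tensor v w $ (k, m, p) = v $ m * sym_map k w $ p"
proof -
  have "torsion_tensor v w $ (k, m, p) =
      (\<Sum>l\<in>UNIV. if l = k then v $ m * sym_map l w $ p else 0)"
    unfolding torsion_tensor_def sum_component
    by (intro sum.cong refl) (simp add: axis_def)
  then show ?thesis by simp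
qed

lemma bilinear_torsion_tensor: "bilinear torsion_tensor"
  unfolding bilinear_def
  by (auto intro!: linearI simp: vec_eq_iff torsion_tensor_nth linear_add[OF linear_sym_map]
      linear_cmul[OF linear_sym_map] algebra_simps)

lemma torsion_tensor_equivariant:
  assumes "orthogonal_matrix h"
  shows "kron h (kron (tensor3_rep h) (tensor2_rep h)) *v torsion_tensor v w =
     torsion_tensor (tensor3_rep h *v v) (tensor3_rep h *v w)"
proof -
  \<comment> \<open>\<open>h *v axis l 1\<close> is column \<open>l\<close> of \<open>h\<close>; its
    entry \<open>k\<close> is the coefficient with which \<open>sym_map_tensor3_rep\<close> mixes
    the components of phi.\<close>
  have "(\<Sum>l\<in>UNIV. tensor (h *v axis l 1)
          (tensor (tensor3_rep h *v v) (tensor2_rep h *v sym_map l w))) $ (k, m, p) =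
      torsion_tensor (tensor3_rep h *v v) (tensor3_rep h *v w) $ (k, m, p)" for k m p
    by (simp add: torsion_tensor_nth sym_map_tensor3_rep[OF assms] sum_distrib_left
        matrix_vector_mult_basis column_def algebra_simps)
  then show ?thesis
    by (simp add: torsion_tensor_def[of v] linear_sum[OF matrix_vector_mul_linear] kron_tensor
        vec_eq_iff)
qed

lemma torsion_tensor_in_tensor_product:
  "v \<in> W \<Longrightarrow> torsion_tensor v w \<in> UNIV \<otimes> W \<otimes> Sym2_0"
  unfolding torsion_tensor_def sym_map_def
  by (intro subspace_sum subspace_tensor_product tensor_in_tensor_product
      sym_tracefree_in_Sym2_0 UNIV_I)

text \<open>Equivariance of phi makes the sum of \<open>w\<close> tensor phi(\<open>w\<close>) over
  an orthonormal basis of \<open>W\<close> invariant. By (a) it is 0, and independence of the basis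
  then gives phi = 0 on \<open>W\<close>.\<close>

lemma sym_map_eq_0:
  fixes W :: "(real^('n::finite \<times> 'n \<times> 'n)) set"
  assumes G: "orthogonal_subgroup G" and W: "submodule G tensor3_rep W"
    and inv: "invariants G (\<lambda>h. kron h (kron (tensor3_rep h) (tensor2_rep h)))
           (UNIV \<otimes> W \<otimes> Sym2_0) = {0}"
    and "x \<in> W"
  shows "sym_map k x = 0"
proof -
  have sub: "subspace W"
    using W by (simp add: submodule_def)
  then obtain B where B: "orthonormal_basis W B"
    by (rule orthonormal_basis_exists)
  have BW: "B \<subseteq> W" and fin: "finite B"
    using B span_superset by (auto simp: orthonormal_basis_def)
  define z where "z = (\<Sum>w\<in>B. torsion_tensor w w)"
  have "kron h (kron (tensor3_rep h) (tensor2_rep h)) *v z = z" if h: "h \<in> G" for h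
  proof -
    have o: "orthogonal_matrix h"
      using G h by (simp add: orthogonal_subgroup_def)
    have "transpose h \<in> G"
      using G h by (rule orthogonal_subgroup_transpose)
    then have "(\<Sum>w\<in>B. torsion_tensor (tensor3_rep h *v w) (tensor3_rep h *v w)) = z"
      unfolding z_def using W h o
      by (intro sum_orthonormal_basis_orthogonal_matrix[OF B bilinear_torsion_tensor])
         (auto simp: submodule_def transpose_tensor3_rep orthogonal_matrix_tensor3_rep)
    then show ?thesis
      by (simp add: z_def linear_sum[OF matrix_vector_mul_linear] torsion_tensor_equivariant[OF o])
  qed
  moreover have "z \<in> UNIV \<otimes> W \<otimes> Sym2_0"
    unfolding z_def using BW
    by (intro subspace_sum subspace_tensor_product torsion_tensor_in_tensor_product) auto
  ultimately have "z \<in> {0}"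
    unfolding inv[symmetric] by (simp add: invariants_def)
  \<comment> \<open>Fixing the outer indices \<open>k\<close> and \<open>p\<close> turns
    \<open>z = 0\<close> into a linear relation among the basis vectors.\<close>
  then have 0: "(\<Sum>w\<in>B. sym_map k w $ p *\<^sub>R w) = 0" for p
  proof -
    have "(\<Sum>w\<in>B. sym_map k w $ p *\<^sub>R w) $ m = z $ (k, m, p)" for m
      unfolding z_def sum_component torsion_tensor_nth by (simp add: mult.commute)
    then show ?thesis
      using \<open>z \<in> {0}\<close> by (subst vec_eq_iff) simp
  qed
  have "sym_map k v = 0" if "v \<in> B" for v
  proof -
    have "sym_map k v $ p = (\<Sum>w\<in>B. if w = v then sym_map k w $ p else 0)" for p
      using fin that by simp
    \<comment> \<open>Pairing the relation with \<open>v\<close> isolates the coefficient of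
      \<open>v\<close>.\<close>
    also have "\<dots> p = (\<Sum>w\<in>B. sym_map k w $ p *\<^sub>R w) \<bullet> v" for p
      unfolding inner_sum_left using that
      by (intro sum.cong refl) (simp add: orthonormal_basis_inner[OF B])
    finally show ?thesis
      by (simp add: 0 vec_eq_iff)
  qed
  moreover have "x \<in> span B"
    using B \<open>x \<in> W\<close> by (simp add: orthonormal_basis_def)
  ultimately show ?thesis
    using linear_eq_0_on_span[OF linear_sym_map] by blast
qed

section \<open>Vanishing symmetrisation and three-forms\<close>

lemma tensor_product_Alt2_skew:
  assumes "x \<in> UNIV \<otimes> Alt2"
  shows "x $ (i, j, k) = - x $ (i, k, j)"
  using assms unfolding tensor_product_def
proof (induction rule: span_induct_alt)
  case base
  then show ?case by simp
next
  case (step c y z)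
  then obtain u w where y: "y = tensor u w" and "w \<in> Alt2"
    by blast
  then have "w $ (j, k) = - w $ (k, j)"
    unfolding Alt2_def by blast
  then have "y $ (i, j, k) = - y $ (i, k, j)"
    by (simp add: y)
  then show ?case
    using step by simp
qed

lemma sym_map_0_imp_Alt3:
  fixes x :: "real^('n::finite \<times> 'n \<times> 'n)"
  assumes skew: "\<And>i j k. x $ (i, j, k) = - x $ (i, k, j)"
    and 0: "\<And>k. sym_map k x = 0"
  shows "x \<in> Alt3"
proof -
  define \<tau> where "\<tau> k = (\<Sum>i\<in>UNIV. x $ (i, i, k))" for k
  \<comment> \<open>Entry \<open>(i, j)\<close> of \<open>sym_map k x = 0\<close>, with the trace
    term moved to the right.\<close>
  have *: "x $ (i, j, k) + x $ (j, i, k) = 2 / real CARD('n) * (if i = j then \<tau> k else 0)"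
    for i j k
  proof -
    have "sym_map k x $ (i, j) = 0"
      by (simp add: 0)
    then show ?thesis
      by (auto simp: sym_map_def sym_tracefree_def swap_tensor_def slice_def inner_metric_tensor
          \<tau>_def split: if_splits)
  qed
  have "\<tau> k = 0" for k
  proof -
    \<comment> \<open>This removes one of the two terms of \<open>*\<close> at indices
      \<open>(i, k, i)\<close>, so that summing over \<open>i\<close> expresses the contraction
      through \<tau>.\<close>
    have "x $ (k, i, i) = 0" for i
      using skew[of k i i] by simp
    then have "x $ (i, k, i) = 2 / real CARD('n) * (if i = k then \<tau> i else 0)" for i
      using *[of i k i] by simp
    then have "(\<Sum>i\<in>UNIV. x $ (i, k, i)) =
        2 / real CARD('n) * (\<Sum>i\<in>UNIV. if i = k then \<tau> i else 0)"
      unfolding sum_distrib_left by (rule sum.cong[OF refl])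
    then have "(\<Sum>i\<in>UNIV. x $ (i, k, i)) = 2 / real CARD('n) * \<tau> k"
      by simp
    moreover have "(\<Sum>i\<in>UNIV. x $ (i, k, i)) = - \<tau> k"
      unfolding \<tau>_def sum_negf[symmetric] by (intro sum.cong refl skew)
    ultimately have "(2 / real CARD('n) + 1) * \<tau> k = 0"
      by (simp add: algebra_simps)
    moreover have "2 / real CARD('n) + 1 > 0"
      by (simp add: add_pos_pos)
    ultimately show ?thesis by simp
  qed
  \<comment> \<open>With \<tau> = 0 the right side of \<open>*\<close> vanishes.\<close>
  then have "x $ (i, j, k) = - x $ (j, i, k)" for i j k
    unfolding eq_neg_iff_add_eq_0 * by simp
  then show ?thesis
    unfolding Alt3_def using skew by blast
qed

section \<open>Irreducibility from condition (b)\<close>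

lemma reducible_imp_invariant_Sym2_0:
  fixes U :: "(real^'n::finite) set"
  assumes G: "orthogonal_subgroup G" and U: "submodule G (\<lambda>h. h) U"
    and "U \<noteq> {0}" "U \<noteq> UNIV"
  obtains s where "s \<in> Sym2_0" "s \<noteq> 0" "\<And>h. h \<in> G \<Longrightarrow> tensor2_rep h *v s = s"
proof -
  have sub: "subspace U"
    using U by (simp add: submodule_def)
  then obtain B where B: "orthonormal_basis U B" "card B = dim U"
    by (rule orthonormal_basis_exists)
  \<comment> \<open>The Casimir element of \<open>U\<close> has trace \<open>dim U\<close> and the
    metric has trace n, so this \<open>c\<close> makes \<open>s\<close> trace-free.\<close>
  define c where "c = real (dim U) / real CARD('n)"
  define s where "s = casimir B - c *\<^sub>R metric_tensor"
  have "s \<in> Sym2_0"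
    using casimir_symmetric[of B] trace_casimir[OF B(1)] B(2)
    by (simp add: Sym2_0_def Sym2_def tensor_product_UNIV s_def sum_subtractf c_def)
  moreover have "s \<noteq> 0"
  proof
    assume "s = 0"
    then have cas: "casimir B = c *\<^sub>R metric_tensor"
      by (simp add: s_def)
    obtain u where u: "u \<in> U" "u \<noteq> 0"
      using \<open>U \<noteq> {0}\<close> sub subspace_0 by blast
    \<comment> \<open>Contraction with the Casimir element fixes \<open>u\<close>, whereas
      contraction with \<open>c *\<^sub>R metric_tensor\<close> scales it by \<open>c\<close>. Thus
      \<open>c = 1\<close>, which forces full dimension.\<close>
    have "u $ i = c * u $ i" for i
      using casimir_contract[OF B(1) u(1), of i]
      by (simp add: cas if_distrib if_distribR cong: if_cong)
    with u have "c = 1"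
      by (auto simp: vec_eq_iff)
    then have "dim U = CARD('n)"
      by (simp add: c_def)
    then have "U = UNIV"
      using sub dim_eq_full[of U] span_eq_iff[of U] by simp
    then show False
      using \<open>U \<noteq> UNIV\<close> by simp
  qed
  moreover have "tensor2_rep h *v s = s" if h: "h \<in> G" for h
  proof -
    have o: "orthogonal_matrix h"
      using G h by (simp add: orthogonal_subgroup_def)
    have "transpose h \<in> G"
      using G h by (rule orthogonal_subgroup_transpose)
    then have "tensor2_rep h *v casimir B = casimir B"
      unfolding tensor2_rep_def using U h o
      by (intro casimir_invariant[OF B(1)]) (auto simp: submodule_def)
    then show ?thesis
      by (simp add: s_def matrix_vector_mult_diff_distrib matrix_vector_mult_scaleR
          tensor2_rep_metric_tensor[OF o])
  qed
  ultimately show ?thesis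
    by (rule that)
qed

text \<open>A product of nonzero invariants of \<open>Sym2 W\<close> and \<open>Sym2_0\<close> is a
  nonzero invariant. Nontriviality of \<open>W\<close> is essential: for \<open>W = {0}\<close> the
  condition \<open>inv\<close> holds whether or not \<open>V\<close> is reducible.\<close>

lemma irreducible_if_no_invariants:
  fixes W :: "(real^('n::finite \<times> 'n \<times> 'n)) set"
  assumes G: "orthogonal_subgroup G" and W: "submodule G tensor3_rep W" and "W \<noteq> {0}"
    and inv: "invariants G (\<lambda>h. kron (kron (tensor3_rep h) (tensor3_rep h)) (tensor2_rep h))
           (Sym2 W \<otimes> Sym2_0) = {0}"
  shows "irreducible_rep G (\<lambda>h. h)"
  unfolding irreducible_rep_def
proof (intro allI impI, rule ccontr)
  fix U assume "submodule G (\<lambda>h. h) U" "\<not> (U = {0} \<or> U = UNIV)"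
  then obtain s where s: "s \<in> Sym2_0" "s \<noteq> 0" "\<And>h. h \<in> G \<Longrightarrow> tensor2_rep h *v s = s"
    using reducible_imp_invariant_Sym2_0[OF G] by blast
  have sub: "subspace W"
    using W by (simp add: submodule_def)
  then obtain B where B: "orthonormal_basis W B" "card B = dim W"
    by (rule orthonormal_basis_exists)
  have "dim W \<noteq> 0"
    using \<open>W \<noteq> {0}\<close> sub subspace_0 by (fastforce simp: dim_eq_0)
  \<comment> \<open>Its trace is \<open>dim W\<close>.\<close>
  then have "casimir B \<noteq> 0"
    using trace_casimir[OF B(1)] B(2) by auto
  then have "tensor (casimir B) s \<noteq> 0"
    using s(2) by (simp add: tensor_eq_0_iff)
  moreover have "tensor (casimir B) s \<in> Sym2 W \<otimes> Sym2_0"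
    by (intro tensor_in_tensor_product casimir_in_Sym2[OF B(1)] s(1))
  moreover have "kron (tensor3_rep h) (tensor3_rep h) *v casimir B = casimir B" if h: "h \<in> G" for h
    using W h G orthogonal_subgroup_transpose[OF G h]
    by (intro casimir_invariant[OF B(1)])
       (auto simp: submodule_def transpose_tensor3_rep orthogonal_matrix_tensor3_rep
         orthogonal_subgroup_def)
  ultimately have "tensor (casimir B) s \<in> {0}"
    unfolding inv[symmetric] by (simp add: invariants_def kron_tensor s(3))
  with \<open>tensor (casimir B) s \<noteq> 0\<close> show False
    by simp
qed

section \<open>The intrinsic torsion of a \<open>G\<close>-manifold\<close>

theorem corollary3p4:
  fixes A :: "('m::{t2_space,second_countable_topology}, 'n::finite) atlas"
    and g :: "'m metric"
    and G :: "(real^'n^'n) set"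
    and P :: "'m \<Rightarrow> ('m, 'n) frame set"
    and W :: "(real^('n \<times> 'n \<times> 'n)) set"
  assumes "riemannian_G_manifold A g G P"
    and "submodule G tensor3_rep W"
    and "W \<subseteq> UNIV \<otimes> lie_algebra_perp G"
    and "takes_values_in P (intrinsic_torsion A g G P) W"
    and "invariants G (\<lambda>h. kron h (kron (tensor3_rep h) (tensor2_rep h)))
           (UNIV \<otimes> W \<otimes> Sym2_0) = {0}"
    and "invariants G (\<lambda>h. kron (kron (tensor3_rep h) (tensor3_rep h)) (tensor2_rep h))
           (Sym2 W \<otimes> Sym2_0) = {0}"
  shows "(W \<noteq> {0} \<longrightarrow> irreducible_rep G (\<lambda>h. h)) \<and>
         takes_values_in P (intrinsic_torsion A g G P) Alt3"
proof (intro conjI impI)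
  have G: "orthogonal_subgroup G"
    using assms(1) by (simp add: riemannian_G_manifold_def lie_subgroup_def)
  show "irreducible_rep G (\<lambda>h. h)" if "W \<noteq> {0}"
    using irreducible_if_no_invariants[OF G assms(2) that assms(6)] .
  have "UNIV \<otimes> lie_algebra_perp G \<subseteq> UNIV \<otimes> Alt2"
    unfolding tensor_product_def by (intro span_mono) (auto simp: lie_algebra_perp_def)
  \<comment> \<open>Condition (a) kills the symmetrisation on all of \<open>W\<close>, so this
    inclusion is purely algebraic and passes to the torsion at every adapted frame.\<close>
  then have "W \<subseteq> Alt3"
    using assms(3) sym_map_eq_0[OF G assms(2,5)]
    by (blast intro: sym_map_0_imp_Alt3 tensor_product_Alt2_skew)
  then show "takes_values_in P (intrinsic_torsion A g G P) Alt3"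
    using assms(4) by (auto simp: takes_values_in_def)
qed

end
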